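(* A topological space $X$ is separable and metrizable if and only if $X$ is a $\mathfrak P_0$-space with countable fan open-tightness.
   Context: "Regular" means $T_3$. A subset $A$ of a topological space $X$ accumulates at a point $x\in X$ if each neighborhood of $x$ contains infinitely many points of $A$. A family $\mathcal N$ of subsets of $X$ is a network at $x\in X$ if for any neighborhood $O_x$ of $x$ there is $N\in\mathcal N$ with $x\in N\subset O_x$. It is a Pytkeev network at $x$ if it is a network at $x$ and for each neighborhood $O_x$ of $x$ and each subset $A\subset X$ accumulating at $x$ there is $N\in\mathcal N$ such that $N\subset O_x$ and $N\cap A$ is infinite. It is a Pytkeev network for $X$ if it is a Pytkeev network at each point $x\in X$. A $\mathfrak P_0$-space is a regular space with a countable Pytkeev network. A topological space $X$ has countable fan open-tightness if for each point $x\in X$ and open sets $A_n\subset X$, $n\in\omega$, with $x\in\bigcap_{n\in\omega}\overline{A_n}$ there are finite sets $F_n\subset A_n$, $n\in\omega$, such that for any neighborhood $O_x\subset X$ of $x$ the set $\{n\in\omega:F_n\cap O_x\neq\emptyset\}$ is infinite. *)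

theory Defs
  imports "HOL-Analysis.Analysis"
begin

text \<open>
  Neighbourhoods of a point \<open>x\<close> are taken to be open sets containing \<open>x\<close>. All notions
  below are unaffected if arbitrary (not necessarily open) neighbourhoods are used instead.
\<close>

definition accumulates_at :: "'a topology \<Rightarrow> 'a set \<Rightarrow> 'a \<Rightarrow> bool"
  where "accumulates_at X A x \<longleftrightarrow>
    A \<subseteq> topspace X \<and> x \<in> topspace X \<and>
    (\<forall>U. openin X U \<and> x \<in> U \<longrightarrow> infinite (U \<inter> A))"

definition network_at :: "'a topology \<Rightarrow> 'a set set \<Rightarrow> 'a \<Rightarrow> bool"
  where "network_at X \<N> x \<longleftrightarrow>
    \<N> \<subseteq> Pow (topspace X) \<and>
    (\<forall>U. openin X U \<and> x \<in> U \<longrightarrow> (\<exists>N\<in>\<N>. x \<in> N \<and> N \<subseteq> U))"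

definition Pytkeev_network_at :: "'a topology \<Rightarrow> 'a set set \<Rightarrow> 'a \<Rightarrow> bool"
  where "Pytkeev_network_at X \<N> x \<longleftrightarrow>
    network_at X \<N> x \<and>
    (\<forall>U A. openin X U \<and> x \<in> U \<and> accumulates_at X A x \<longrightarrow>
       (\<exists>N\<in>\<N>. N \<subseteq> U \<and> infinite (N \<inter> A)))"

definition Pytkeev_network :: "'a topology \<Rightarrow> 'a set set \<Rightarrow> bool"
  where "Pytkeev_network X \<N> \<longleftrightarrow>
    \<N> \<subseteq> Pow (topspace X) \<and> (\<forall>x\<in>topspace X. Pytkeev_network_at X \<N> x)"

text \<open>
  ``Regular'' means \<open>T\<^sub>3\<close>; the library's \<^const>\<open>regular_space\<close> does not include the
  \<open>T\<^sub>1\<close> axiom, so it is added explicitly.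
\<close>

definition P0_space :: "'a topology \<Rightarrow> bool"
  where "P0_space X \<longleftrightarrow>
    regular_space X \<and> t1_space X \<and> (\<exists>\<N>. countable \<N> \<and> Pytkeev_network X \<N>)"

definition countable_fan_open_tightness :: "'a topology \<Rightarrow> bool"
  where "countable_fan_open_tightness X \<longleftrightarrow>
    (\<forall>x\<in>topspace X. \<forall>A :: nat \<Rightarrow> 'a set.
       (\<forall>n. openin X (A n)) \<and> x \<in> (\<Inter>n. X closure_of A n) \<longrightarrow>
       (\<exists>F :: nat \<Rightarrow> 'a set. (\<forall>n. finite (F n) \<and> F n \<subseteq> A n) \<and>
          (\<forall>U. openin X U \<and> x \<in> U \<longrightarrow> infinite {n. F n \<inter> U \<noteq> {}})))"

end

theory Submission
  imports Defs
begin

text \<open>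
  A second countable space has all the countability one can ask for: a countable base is a
  countable Pytkeev network, and a decreasing countable neighbourhood base at a point lets one
  choose a single point from each open set \<open>A n\<close> so that the chosen points converge. This
  settles the direction from separable metrizable spaces.

  For the converse, the point is that fan open-tightness turns a countable Pytkeev network into a
  countable base. By regularity the members of the network may be assumed closed. Fix an open set \<open>U\<close> containing
  \<open>x\<close>, list the members of the network inside \<open>U\<close> as \<open>c 0, c 1, \<dots>\<close> and put
  \<open>M n = c 0 \<union> \<dots> \<union> c n\<close>. If no \<open>M n\<close> were a neighbourhood of \<open>x\<close>, then \<open>x\<close> would lie in
  the closure of each of the open sets \<open>- M n\<close>, and fan open-tightness would give finite sets
  \<open>F n\<close> disjoint from \<open>M n\<close> whose union accumulates at \<open>x\<close>. Some \<open>c j\<close> would then meet this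
  union in an infinite set; but \<open>c j\<close> can meet only \<open>F n\<close> with \<open>n < j\<close>, a contradiction. Hence
  the interiors of finite unions of members of the network form a countable base
  (\<open>closed_Pytkeev_network_finite_union_neighbourhood\<close>,
  \<open>P0_space_fan_open_tight_imp_second_countable\<close>), and Urysohn's metrization theorem applies.
\<close>

section \<open>From Pytkeev networks to countable bases\<close>

text \<open>
  In a regular space every neighbourhood of a point contains a closed one, so a network member
  found inside the smaller neighbourhood has its closure inside the larger one. Closedness is
  what makes complements of finite unions of network members open, as fan open-tightness
  requires.
\<close>

lemma Pytkeev_network_closures:
  assumes reg: "regular_space X" and \<N>: "Pytkeev_network X \<N>"
  shows "Pytkeev_network X ((closure_of) X ` \<N>)"
proof -
  have sub: "N \<subseteq> X closure_of N" if "N \<in> \<N>" for N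
    using \<N> that unfolding Pytkeev_network_def by (meson Pow_iff closure_of_subset subsetD)
  have shrink: "\<exists>V. openin X V \<and> x \<in> V \<and> (\<forall>N. N \<subseteq> V \<longrightarrow> X closure_of N \<subseteq> U)"
    if U: "openin X U" "x \<in> U" for U x
  proof -
    obtain V C where V: "openin X V" "closedin X C" "x \<in> V" "V \<subseteq> C" "C \<subseteq> U"
      using reg U unfolding neighbourhood_base_of_closedin [symmetric] neighbourhood_base_of
      by metis
    then have "X closure_of N \<subseteq> U" if "N \<subseteq> V" for N
      using that closure_of_minimal [of N C X] by blast
    with V show ?thesis by blast
  qed
  have "Pytkeev_network_at X ((closure_of) X ` \<N>) x" if x: "x \<in> topspace X" for x
    unfolding Pytkeev_network_at_def network_at_def
  proof (intro conjI allI impI)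
    show "(closure_of) X ` \<N> \<subseteq> Pow (topspace X)"
      by (simp add: image_subset_iff closure_of_subset_topspace)
  next
    fix U assume "openin X U \<and> x \<in> U"
    then obtain V where V: "openin X V" "x \<in> V" "\<And>N. N \<subseteq> V \<Longrightarrow> X closure_of N \<subseteq> U"
      using shrink by meson
    then obtain N where "N \<in> \<N>" "x \<in> N" "N \<subseteq> V"
      using \<N> x unfolding Pytkeev_network_def Pytkeev_network_at_def network_at_def by meson
    then have "X closure_of N \<in> (closure_of) X ` \<N>" "x \<in> X closure_of N" "X closure_of N \<subseteq> U"
      using V(3) sub [THEN subsetD] by auto
    then show "\<exists>N\<in>(closure_of) X ` \<N>. x \<in> N \<and> N \<subseteq> U" by meson
  next
    fix U A assume UA: "openin X U \<and> x \<in> U \<and> accumulates_at X A x"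
    then obtain V where V: "openin X V" "x \<in> V" "\<And>N. N \<subseteq> V \<Longrightarrow> X closure_of N \<subseteq> U"
      using shrink by meson
    then obtain N where N: "N \<in> \<N>" "N \<subseteq> V" "infinite (N \<inter> A)"
      using \<N> x UA unfolding Pytkeev_network_def Pytkeev_network_at_def by meson
    have "infinite (X closure_of N \<inter> A)"
      using N sub by (meson Int_mono finite_subset order_refl)
    with N V show "\<exists>N\<in>(closure_of) X ` \<N>. N \<subseteq> U \<and> infinite (N \<inter> A)" by blast
  qed
  then show ?thesis
    unfolding Pytkeev_network_def by (simp add: image_subset_iff closure_of_subset_topspace)
qed

text \<open>
  The heart of the argument: fan open-tightness turns the failure of all finite unions to be
  neighbourhoods of \<open>x\<close> into a set accumulating at \<open>x\<close> that every network member inside \<open>U\<close>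
  meets in a finite set only.
\<close>

lemma closed_Pytkeev_network_finite_union_neighbourhood:
  assumes t1: "t1_space X" and fan: "countable_fan_open_tightness X"
    and \<C>: "Pytkeev_network_at X \<C> x" "countable \<C>" "\<And>C. C \<in> \<C> \<Longrightarrow> closedin X C"
    and U: "openin X U" "x \<in> U"
  obtains \<F> where "finite \<F>" "\<F> \<subseteq> \<C>" "x \<in> X interior_of \<Union>\<F>" "\<Union>\<F> \<subseteq> U"
proof -
  have x: "x \<in> topspace X"
    using U openin_subset by blast
  define \<D> where "\<D> = {C \<in> \<C>. C \<subseteq> U}"
  obtain D where D: "D \<in> \<D>" "x \<in> D"
    using \<C>(1) U unfolding Pytkeev_network_at_def network_at_def \<D>_def
    by (metis (mono_tags, lifting) mem_Collect_eq)
  define c where "c = from_nat_into \<D>"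
  have range_c: "range c = \<D>"
    unfolding c_def using D \<C>(2) by (intro range_from_nat_into) (auto simp: \<D>_def)
  define M where "M n = (\<Union>i\<le>n. c i)" for n
  have M_mono: "M m \<subseteq> M n" if "m \<le> n" for m n
    using that unfolding M_def by (meson UN_mono atMost_subset_iff subset_refl)
  have "\<exists>n. x \<in> X interior_of M n"
  proof (rule ccontr)
    assume no: "\<nexists>n. x \<in> X interior_of M n"
    have "closedin X (M n)" for n
      unfolding M_def using range_c \<C>(3) \<D>_def by (intro closedin_Union) auto
    then have "\<forall>n. openin X (topspace X - M n)"
      by blast
    moreover have "x \<in> (\<Inter>n. X closure_of (topspace X - M n))"
      using no x by (simp add: closure_of_complement)
    ultimately have "\<exists>F. (\<forall>n. finite (F n) \<and> F n \<subseteq> topspace X - M n) \<and>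
        (\<forall>V. openin X V \<and> x \<in> V \<longrightarrow> infinite {n. F n \<inter> V \<noteq> {}})"
      using fan [unfolded countable_fan_open_tightness_def, rule_format, OF x,
          of "\<lambda>n. topspace X - M n"] by blast
    then obtain F where F: "\<And>n. finite (F n)" "\<And>n. F n \<subseteq> topspace X - M n"
      and hit: "\<And>V. openin X V \<Longrightarrow> x \<in> V \<Longrightarrow> infinite {n. F n \<inter> V \<noteq> {}}"
      by metis
    define A where "A = (\<Union>n. F n)"
    \<comment> \<open>Some network member inside \<open>U\<close> contains \<open>x\<close> itself, so \<open>x\<close> lies in only finitely
      many \<open>F n\<close>: for large \<open>n\<close> the sets \<open>F n\<close> meet neighbourhoods of \<open>x\<close> in other points.\<close>
    obtain k where k: "x \<in> c k"
      using D range_c by blast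
    have xF: "x \<notin> F n" if "n \<ge> k" for n
      using that k F(2) [of n] unfolding M_def by blast
    have "infinite (V \<inter> A)" if V: "openin X V" "x \<in> V" for V
    proof
      assume fin: "finite (V \<inter> A)"
      \<comment> \<open>By the \<open>T\<^sub>1\<close> axiom, deleting the finitely many points of \<open>A\<close> other than \<open>x\<close> leaves a
        neighbourhood of \<open>x\<close>, which the \<open>F n\<close> can meet only in \<open>x\<close>.\<close>
      define W where "W = V - (V \<inter> A - {x})"
      have "closedin X (V \<inter> A - {x})"
        using t1 fin V openin_subset unfolding t1_space_closedin_finite by blast
      then have "openin X W" "x \<in> W"
        unfolding W_def using V by auto
      then have "infinite {n. F n \<inter> W \<noteq> {}}"
        by (rule hit)
      moreover have "{n. F n \<inter> W \<noteq> {}} \<subseteq> {..<k}"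
        using xF unfolding W_def A_def by (auto simp: not_less [symmetric])
      ultimately show False
        using finite_subset by blast
    qed
    moreover have "A \<subseteq> topspace X"
      using F(2) unfolding A_def by blast
    ultimately have "accumulates_at X A x"
      using x unfolding accumulates_at_def by blast
    then obtain C where C: "C \<in> \<C>" "C \<subseteq> U" "infinite (C \<inter> A)"
      using \<C>(1) U unfolding Pytkeev_network_at_def by blast
    then obtain j where j: "C = c j"
      using range_c unfolding \<D>_def by blast
    have "F n \<inter> C = {}" if "n \<ge> j" for n
      using that F(2) [of n] j unfolding M_def by blast
    then have "C \<inter> A \<subseteq> (\<Union>n<j. F n)"
      unfolding A_def by (force simp: not_less [symmetric])
    with F(1) have "finite (C \<inter> A)"
      by (meson finite_UN finite_lessThan finite_subset)
    with C show False by blast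
  qed
  then obtain n where "x \<in> X interior_of M n" ..
  then show thesis
    using range_c by (intro that [of "c ` {..n}"]) (auto simp: M_def \<D>_def)
qed

lemma P0_space_fan_open_tight_imp_second_countable:
  assumes "P0_space X" and fan: "countable_fan_open_tightness X"
  shows "second_countable X"
proof -
  obtain \<N> where reg: "regular_space X" and t1: "t1_space X"
    and \<N>: "countable \<N>" "Pytkeev_network X \<N>"
    using assms unfolding P0_space_def by blast
  define \<C> where "\<C> = (closure_of) X ` \<N>"
  have \<C>: "countable \<C>" "Pytkeev_network X \<C>" "\<And>C. C \<in> \<C> \<Longrightarrow> closedin X C"
    using \<N> Pytkeev_network_closures [OF reg] unfolding \<C>_def by auto
  define \<B> where "\<B> = Union ` {\<F>. finite \<F> \<and> \<F> \<subseteq> \<C>}"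
  have "\<exists>V. openin X V \<and> (\<exists>B\<in>\<B>. x \<in> V \<and> V \<subseteq> B \<and> B \<subseteq> U)"
    if U: "openin X U" "x \<in> U" for U x
  proof -
    have "Pytkeev_network_at X \<C> x"
      using \<C>(2) U openin_subset unfolding Pytkeev_network_def by blast
    then obtain \<F> where \<F>: "finite \<F>" "\<F> \<subseteq> \<C>" "x \<in> X interior_of \<Union>\<F>" "\<Union>\<F> \<subseteq> U"
      using closed_Pytkeev_network_finite_union_neighbourhood [OF t1 fan _ \<C>(1,3) U] by metis
    then have "\<Union>\<F> \<in> \<B>"
      unfolding \<B>_def by blast
    with \<F> show ?thesis
      by (meson interior_of_subset openin_interior_of)
  qed
  then have "neighbourhood_base_of (\<lambda>B. B \<in> \<B>) X"
    unfolding neighbourhood_base_of by meson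
  moreover have "countable \<B>"
    unfolding \<B>_def using countable_Collect_finite_subset [OF \<C>(1)] by simp
  ultimately show ?thesis
    unfolding second_countable_neighbourhood_base by blast
qed

section \<open>Urysohn's metrization theorem\<close>

text \<open>
  Maps that separate points from closed sets are jointly injective by the \<open>T\<^sub>0\<close> axiom. The
  evaluation map is open onto its image because a preimage of an open \<open>W\<close> under a single
  coordinate that fits inside \<open>U\<close> makes the image of \<open>U\<close> a relative neighbourhood of the point.
\<close>

lemma embedding_map_product_topology:
  assumes cont: "\<And>i. i \<in> I \<Longrightarrow> continuous_map X (Y i) (f i)" and t0: "t0_space X"
    and sep: "\<And>U x. openin X U \<Longrightarrow> x \<in> U \<Longrightarrow>
      \<exists>i\<in>I. \<exists>W. openin (Y i) W \<and> f i x \<in> W \<and> {y \<in> topspace X. f i y \<in> W} \<subseteq> U"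
  shows "embedding_map X (product_topology Y I) (\<lambda>x. \<lambda>i\<in>I. f i x)"
proof -
  define e where "e = (\<lambda>x. \<lambda>i\<in>I. f i x)"
  have cont_e: "continuous_map X (product_topology Y I) e"
    unfolding e_def using cont by (auto simp: continuous_map_componentwise)
  have "x = y" if xy: "x \<in> topspace X" "y \<in> topspace X" and e: "e x = e y" for x y
  proof (rule ccontr)
    assume "x \<noteq> y"
    then obtain U where U: "openin X U" "x \<notin> U \<longleftrightarrow> y \<in> U"
      using t0 xy unfolding t0_space_def by metis
    have "f i x = f i y" if "i \<in> I" for i
      using fun_cong [OF e, of i] that by (simp add: e_def)
    with U xy sep [OF U(1)] show False
      by (smt (verit) mem_Collect_eq subset_eq)
  qed
  then have inj: "inj_on e (topspace X)"
    by (rule inj_onI)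
  have "open_map X (subtopology (product_topology Y I) (e ` topspace X)) e"
    unfolding open_map_def
  proof (intro allI impI)
    fix U assume U: "openin X U"
    show "openin (subtopology (product_topology Y I) (e ` topspace X)) (e ` U)"
    proof (subst openin_subopen, intro ballI)
      fix z assume "z \<in> e ` U"
      then obtain x where x: "x \<in> U" "z = e x" by blast
      obtain i W where i: "i \<in> I" "openin (Y i) W" "f i x \<in> W"
        "{y \<in> topspace X. f i y \<in> W} \<subseteq> U"
        using sep [OF U x(1)] by blast
      define T where "T = {g \<in> topspace (product_topology Y I). g i \<in> W}"
      have "openin (product_topology Y I) T"
        unfolding T_def
        using i by (intro openin_continuous_map_preimage continuous_map_product_projection) auto
      then have "openin (subtopology (product_topology Y I) (e ` topspace X)) (T \<inter> e ` topspace X)"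
        unfolding openin_subtopology by blast
      moreover have "x \<in> topspace X"
        using U x openin_subset by blast
      moreover have "z \<in> T"
        using \<open>x \<in> topspace X\<close> continuous_map_image_subset_topspace [OF cont_e] i x
        unfolding T_def by (auto simp: e_def simp del: topspace_product_topology)
      moreover have "T \<inter> e ` topspace X \<subseteq> e ` U"
        using i unfolding T_def by (auto simp: e_def)
      ultimately show "\<exists>T. openin (subtopology (product_topology Y I) (e ` topspace X)) T \<and>
          z \<in> T \<and> T \<subseteq> e ` U"
        using x by blast
    qed
  qed
  then have "homeomorphic_map X (subtopology (product_topology Y I) (e ` topspace X)) e"
    using inj cont_e continuous_map_image_subset_topspace [OF cont_e]
    by (intro bijective_open_imp_homeomorphic_map)
      (auto simp: continuous_map_in_subtopology)
  then show ?thesis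
    unfolding embedding_map_def e_def .
qed

text \<open>
  A regular second countable space is normal. Countably many Urysohn functions, one for each
  pair \<open>(V, W)\<close> of basic sets with the closure of \<open>V\<close> inside \<open>W\<close>, separate points from closed
  sets, and so embed the space into a countable power of the real line.
\<close>

theorem Urysohn_metrization:
  assumes reg: "regular_space X" and t1: "t1_space X" and sc: "second_countable X"
  shows "metrizable_space X"
proof -
  have normal: "normal_space X"
    using reg sc by (simp add: regular_Lindelof_imp_normal_space second_countable_imp_Lindelof_space)
  obtain \<B> where \<B>: "countable \<B>" "\<And>V. V \<in> \<B> \<Longrightarrow> openin X V"
    "\<And>U x. openin X U \<Longrightarrow> x \<in> U \<Longrightarrow> \<exists>V\<in>\<B>. x \<in> V \<and> V \<subseteq> U"
    using sc unfolding second_countable_def by metis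
  define P where "P = {(V, W). V \<in> \<B> \<and> W \<in> \<B> \<and> X closure_of V \<subseteq> W}"
  have "\<forall>p\<in>P. \<exists>f. continuous_map X euclideanreal f \<and>
      f ` (X closure_of fst p) \<subseteq> {0} \<and> f ` (topspace X - snd p) \<subseteq> {1}"
  proof
    fix p assume "p \<in> P"
    then have "closedin X (topspace X - snd p)" "disjnt (X closure_of fst p) (topspace X - snd p)"
      using \<B>(2) unfolding P_def by (auto simp: disjnt_iff)
    then show "\<exists>f. continuous_map X euclideanreal f \<and>
        f ` (X closure_of fst p) \<subseteq> {0} \<and> f ` (topspace X - snd p) \<subseteq> {1}"
      using Urysohn_lemma_alt [OF normal closedin_closure_of] by metis
  qed
  then obtain f where f: "\<And>p. p \<in> P \<Longrightarrow> continuous_map X euclideanreal (f p)"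
    "\<And>p. p \<in> P \<Longrightarrow> f p ` (X closure_of fst p) \<subseteq> {0}"
    "\<And>p. p \<in> P \<Longrightarrow> f p ` (topspace X - snd p) \<subseteq> {1}"
    unfolding bchoice_iff by metis
  have "\<exists>p\<in>P. \<exists>S. openin euclideanreal S \<and> f p x \<in> S \<and> {y \<in> topspace X. f p y \<in> S} \<subseteq> U"
    if U: "openin X U" "x \<in> U" for U x
  proof -
    obtain W where W: "W \<in> \<B>" "x \<in> W" "W \<subseteq> U"
      using \<B>(3) U by blast
    obtain G C where G: "openin X G" "closedin X C" "x \<in> G" "G \<subseteq> C" "C \<subseteq> W"
      using reg \<B>(2) W unfolding neighbourhood_base_of_closedin [symmetric] neighbourhood_base_of
      by metis
    obtain V where V: "V \<in> \<B>" "x \<in> V" "V \<subseteq> G"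
      using \<B>(3) G by blast
    have "X closure_of V \<subseteq> W"
      using V G closure_of_minimal [of V C X] by blast
    then have p: "(V, W) \<in> P"
      using V W unfolding P_def by blast
    have "x \<in> X closure_of V"
      using V \<B>(2) closure_of_subset [OF openin_subset] by blast
    then have "f (V, W) x = 0"
      using f(2) [OF p] by auto
    moreover have "y \<in> U" if "y \<in> topspace X" "f (V, W) y < 1" for y
      using that f(3) [OF p] W by force
    ultimately show ?thesis
      using p by (intro bexI [of _ "(V, W)"] exI [of _ "{..<1}"]) auto
  qed
  then have "embedding_map X (product_topology (\<lambda>_. euclideanreal) P) (\<lambda>x. \<lambda>p\<in>P. f p x)"
    using f(1) t1 by (intro embedding_map_product_topology t1_imp_t0_space) auto
  then have "X homeomorphic_space subtopology (product_topology (\<lambda>_. euclideanreal) P)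
      ((\<lambda>x. \<lambda>p\<in>P. f p x) ` topspace X)"
    by (rule embedding_map_imp_homeomorphic_space)
  moreover have "countable P"
    by (rule countable_subset [of _ "\<B> \<times> \<B>"]) (use \<B>(1) in \<open>auto simp: P_def\<close>)
  then have "metrizable_space (product_topology (\<lambda>_. euclideanreal) P)"
    unfolding metrizable_space_product_topology
    by (auto simp: metrizable_space_euclidean intro: countable_subset)
  ultimately show ?thesis
    using homeomorphic_metrizable_space metrizable_space_subtopology by blast
qed

section \<open>Consequences of countability axioms\<close>

lemma separable_metrizable_imp_second_countable:
  assumes "separable_space X" and "metrizable_space X"
  shows "second_countable X"
proof -
  obtain S d where "Metric_space S d" and X: "X = Metric_space.mtopology S d"
    using assms unfolding metrizable_space_def by blast
  then interpret Metric_space S d by blast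
  obtain D where D: "countable D" "D \<subseteq> S" "mtopology closure_of D = S"
    using assms unfolding separable_space_def X by auto
  define \<B> where "\<B> = (\<lambda>(a, n). mball a (inverse (real (Suc n)))) ` (D \<times> UNIV)"
  have "\<exists>V\<in>\<B>. x \<in> V \<and> V \<subseteq> U" if U: "openin mtopology U" "x \<in> U" for U x
  proof -
    obtain r where r: "r > 0" "mball x r \<subseteq> U" and x: "x \<in> S"
      using U unfolding openin_mtopology by blast
    obtain n where n: "inverse (real (Suc n)) < r / 2"
      using r reals_Archimedean [of "r / 2"] by auto
    obtain a where a: "a \<in> D" "a \<in> mball x (inverse (real (Suc n)))"
      using x D(3) r n unfolding metric_closure_of
      by (smt (verit, best) inverse_positive_iff_positive mem_Collect_eq of_nat_0_less_iff zero_less_Suc)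
    then have ax: "d a x < inverse (real (Suc n))"
      by (simp add: commute)
    have "y \<in> U" if "y \<in> mball a (inverse (real (Suc n)))" for y
    proof -
      have "d x y \<le> d x a + d a y"
        using that x by (intro triangle) auto
      then have "d x y < r"
        using ax n that commute [of a x] by auto
      with that x r show ?thesis by auto
    qed
    moreover have "x \<in> mball a (inverse (real (Suc n)))"
      using ax a x by auto
    ultimately show ?thesis
      using a(1) unfolding \<B>_def by blast
  qed
  moreover have "countable \<B>" "\<forall>V\<in>\<B>. openin mtopology V"
    using D(1) unfolding \<B>_def by auto
  ultimately show ?thesis
    unfolding second_countable_def X by blast
qed

text \<open>
  A basic set \<open>V\<close> with \<open>x \<in> V\<close> is itself a neighbourhood of \<open>x\<close>, so it meets every set
  accumulating at \<open>x\<close> infinitely often.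
\<close>

lemma second_countable_imp_countable_Pytkeev_network:
  assumes "second_countable X"
  shows "\<exists>\<N>. countable \<N> \<and> Pytkeev_network X \<N>"
proof -
  obtain \<B> where \<B>: "countable \<B>" "\<And>V. V \<in> \<B> \<Longrightarrow> openin X V"
    "\<And>U x. openin X U \<Longrightarrow> x \<in> U \<Longrightarrow> \<exists>V\<in>\<B>. x \<in> V \<and> V \<subseteq> U"
    using assms unfolding second_countable_def by metis
  have "\<B> \<subseteq> Pow (topspace X)"
    using \<B>(2) openin_subset by blast
  moreover have "\<exists>N\<in>\<B>. N \<subseteq> U \<and> infinite (N \<inter> A)"
    if UA: "openin X U \<and> x \<in> U \<and> accumulates_at X A x" for U A x
  proof -
    obtain V where "V \<in> \<B>" "x \<in> V" "V \<subseteq> U"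
      using \<B>(3) UA by meson
    with \<B>(2) UA show ?thesis
      unfolding accumulates_at_def by blast
  qed
  ultimately show ?thesis
    unfolding Pytkeev_network_def Pytkeev_network_at_def network_at_def using \<B>(1,3) by metis
qed

text \<open>
  With a decreasing neighbourhood base \<open>V n\<close> at \<open>x\<close>, singletons from \<open>A n \<inter> V n\<close> serve as the
  finite sets: they lie in a given neighbourhood for all large \<open>n\<close>.
\<close>

lemma first_countable_imp_fan_open_tight:
  assumes "first_countable X"
  shows "countable_fan_open_tightness X"
  unfolding countable_fan_open_tightness_def
proof (intro ballI allI impI)
  fix x and A :: "nat \<Rightarrow> 'a set"
  assume x: "x \<in> topspace X"
    and A: "(\<forall>n. openin X (A n)) \<and> x \<in> (\<Inter>n. X closure_of A n)"
  obtain \<B> where \<B>: "countable \<B>" "\<And>V. V \<in> \<B> \<Longrightarrow> openin X V"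
    "\<And>U. openin X U \<Longrightarrow> x \<in> U \<Longrightarrow> \<exists>V\<in>\<B>. x \<in> V \<and> V \<subseteq> U"
    using assms x unfolding first_countable_def by metis
  define \<B>x where "\<B>x = {V \<in> \<B>. x \<in> V}"
  have "\<B>x \<noteq> {}"
    using \<B>(3) [OF openin_topspace x] unfolding \<B>x_def by blast
  then obtain b :: "nat \<Rightarrow> 'a set" where b: "range b = \<B>x"
    using \<B>(1) range_from_nat_into [of \<B>x] unfolding \<B>x_def by (metis countable_Collect)
  define V where "V n = (\<Inter>i\<le>n. b i)" for n
  have "openin X (V n) \<and> x \<in> V n" for n
    unfolding V_def using b \<B>(2) unfolding \<B>x_def by (auto intro!: openin_INT2)
  then have "\<exists>a. a \<in> A n \<and> a \<in> V n" for n
    using A by (metis INT_iff UNIV_I in_closure_of)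
  then obtain a where a: "\<And>n. a n \<in> A n" "\<And>n. a n \<in> V n"
    by metis
  have "infinite {n. {a n} \<inter> U \<noteq> {}}" if U: "openin X U \<and> x \<in> U" for U
  proof -
    obtain k where "b k \<subseteq> U"
      using \<B>(3) U b unfolding \<B>x_def by (metis (mono_tags, lifting) mem_Collect_eq rangeE)
    then have "{k..} \<subseteq> {n. {a n} \<inter> U \<noteq> {}}"
      using a(2) unfolding V_def by auto
    then show ?thesis
      using infinite_Ici finite_subset by blast
  qed
  with a(1) show "\<exists>F. (\<forall>n. finite (F n) \<and> F n \<subseteq> A n) \<and>
      (\<forall>U. openin X U \<and> x \<in> U \<longrightarrow> infinite {n. F n \<inter> U \<noteq> {}})"
    by (intro exI [of _ "\<lambda>n. {a n}"]) auto
qed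

theorem corollary1p13:
  fixes X :: "'a topology"
  shows "separable_space X \<and> metrizable_space X \<longleftrightarrow>
         P0_space X \<and> countable_fan_open_tightness X"
proof
  assume "separable_space X \<and> metrizable_space X"
  then show "P0_space X \<and> countable_fan_open_tightness X"
    unfolding P0_space_def
    by (simp add: metrizable_imp_regular_space metrizable_imp_t1_space
        second_countable_imp_countable_Pytkeev_network separable_metrizable_imp_second_countable
        first_countable_imp_fan_open_tight metrizable_imp_first_countable)
next
  assume X: "P0_space X \<and> countable_fan_open_tightness X"
  then have "second_countable X"
    by (simp add: P0_space_fan_open_tight_imp_second_countable)
  with X show "separable_space X \<and> metrizable_space X"
    unfolding P0_space_def
    by (simp add: Urysohn_metrization second_countable_imp_separable_space)
qed

end
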